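(* For every $n\ge1$, $R_n(134/2)$ is the set of all restricted growth functions $w$ of length $n$ such that every letter occurring in $w$ is either a block letter or a block-singleton letter of $w$.
   Context: A set partition $\sigma$ of $[n]=\{1,\dots,n\}$ is written $\sigma=B_1/B_2/\dots/B_m$ with blocks ordered so that $\min B_1<\dots<\min B_m$. For $A\subseteq[n]$, the subpartition $A\cap\sigma$ is the set partition of $A$ formed by the nonempty sets $A\cap B_i$; it is standardized by replacing its smallest element by $1$, the next smallest by $2$, and so on. $\sigma$ contains a pattern $\pi$ (a set partition of some $[k]$) if some subpartition of $\sigma$ standardizes to $\pi$; otherwise $\sigma$ avoids $\pi$. $\Pi_n(\pi)$ is the set of set partitions of $[n]$ avoiding $\pi$. A restricted growth function (RGF) of length $n$ is a word $w=w_1\cdots w_n$ of positive integers with $w_1=1$ and $w_i\le 1+\max\{w_1,\dots,w_{i-1}\}$ for $i\ge2$. To $\sigma=B_1/\dots/B_m$ corresponds the RGF $w(\sigma)$ with $w_i=j$ if $i\in B_j$. $R_n(\pi)=\{w(\sigma):\sigma\in\Pi_n(\pi)\}$. The pattern $134/2$ is the set partition $\{1,3,4\},\{2\}$ of $[4]$. A block of $a$s in $w$ is a maximal run of consecutive letters equal to $a$. A letter $a$ of $w$ is a block letter if all its occurrences in $w$ form a single block (of one or more $a$s). A letter $a$ is a block-singleton letter if its first occurrence begins a block of one or more $a$s and, after some letter different from $a$, there is exactly one more occurrence of $a$ in $w$ (so the occurrences of $a$ are one block followed later by one separate single $a$). *)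

theory Defs
  imports Main "HOL-Library.Disjoint_Sets"
begin

definition subpartition :: "nat set \<Rightarrow> nat set set \<Rightarrow> nat set set" where
  "subpartition A \<sigma> = {A \<inter> B | B. B \<in> \<sigma>} - {{}}"

(* The k-th smallest element of the ground set is replaced by k. *)
definition standardize :: "nat set set \<Rightarrow> nat set set" where
  "standardize \<tau> = (\<lambda>B. (\<lambda>x. card {y \<in> \<Union>\<tau>. y \<le> x}) ` B) ` \<tau>"

definition contains_pattern :: "nat set set \<Rightarrow> nat set set \<Rightarrow> bool" where
  "contains_pattern \<sigma> \<pi> \<longleftrightarrow> (\<exists>A \<subseteq> \<Union>\<sigma>. standardize (subpartition A \<sigma>) = \<pi>)"

definition avoiding_partitions :: "nat \<Rightarrow> nat set set \<Rightarrow> nat set set set" where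
  "avoiding_partitions n \<pi> = {\<sigma>. partition_on {1..n} \<sigma> \<and> \<not> contains_pattern \<sigma> \<pi>}"

(* B_1, ..., B_m with min B_1 < ... < min B_m; list positions are 0-based. *)
definition ordered_blocks :: "nat set set \<Rightarrow> nat set list" where
  "ordered_blocks \<sigma> = sorted_key_list_of_set Min \<sigma>"

(* The Suc turns the 0-based position of the block containing i into its index j in B_j.
   For words, the letter w_i is w ! (i - 1). *)
definition rgf_of :: "nat \<Rightarrow> nat set set \<Rightarrow> nat list" where
  "rgf_of n \<sigma> =
     map (\<lambda>i. Suc (THE j. j < length (ordered_blocks \<sigma>) \<and> i \<in> ordered_blocks \<sigma> ! j)) [1..<Suc n]"

definition avoiding_rgfs :: "nat \<Rightarrow> nat set set \<Rightarrow> nat list set" where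
  "avoiding_rgfs n \<pi> = rgf_of n ` avoiding_partitions n \<pi>"

definition is_rgf :: "nat list \<Rightarrow> bool" where
  "is_rgf w \<longleftrightarrow> w \<noteq> [] \<and> (\<forall>a \<in> set w. 1 \<le> a) \<and> w ! 0 = 1 \<and>
     (\<forall>i. 1 \<le> i \<and> i < length w \<longrightarrow> w ! i \<le> 1 + Max (set (take i w)))"

definition occurrences :: "nat list \<Rightarrow> nat \<Rightarrow> nat set" where
  "occurrences w a = {k. k < length w \<and> w ! k = a}"

(* A block of a's in w, i.e. a maximal run of a's, occupying the positions i, ..., j - 1. *)
definition letter_block :: "nat list \<Rightarrow> nat \<Rightarrow> nat \<Rightarrow> nat \<Rightarrow> bool" where
  "letter_block w a i j \<longleftrightarrow> i < j \<and> j \<le> length w \<and> (\<forall>k \<in> {i..<j}. w ! k = a) \<and>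
     (i = 0 \<or> w ! (i - 1) \<noteq> a) \<and> (j = length w \<or> w ! j \<noteq> a)"

definition block_letter :: "nat list \<Rightarrow> nat \<Rightarrow> bool" where
  "block_letter w a \<longleftrightarrow> (\<exists>i j. letter_block w a i j \<and> occurrences w a = {i..<j})"

(* By maximality of the block, j < l forces w ! j to be a letter different from a. *)
definition block_singleton_letter :: "nat list \<Rightarrow> nat \<Rightarrow> bool" where
  "block_singleton_letter w a \<longleftrightarrow>
     (\<exists>i j l. letter_block w a i j \<and> j < l \<and> l < length w \<and>
        occurrences w a = {i..<j} \<union> {l})"

end

theory Submission
  imports Defs
begin

text \<open>
  Two positions carry the same letter of \<open>w(\<sigma>)\<close> iff they lie in the same block of \<open>\<sigma>\<close>, so \<open>\<sigma>\<close>
  contains 134/2 iff some letter \<open>a\<close> of \<open>w(\<sigma>)\<close> occurs, is interrupted by a different letter, and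
  later occurs at least twice more. Looking at the first block of \<open>a\<close>s, this fails for \<open>a\<close> iff at
  most one \<open>a\<close> remains after it. Every restricted growth function \<open>w\<close> is some \<open>w(\<sigma>)\<close>: take as
  blocks the position sets of the letters; they are ordered by their minima because each
  letter of \<open>w\<close> is preceded by all smaller ones.
\<close>

section \<open>Restricted growth through earlier occurrences of smaller letters\<close>

text \<open>The running maximum is traded for a condition on first occurrences, which is what the
  order of block minima provides. A letter exceeds the preceding maximum by at most one, so
  induction on the position reaches every smaller letter. Conversely, an earlier occurrence of
  \<open>w ! i - 1\<close> bounds \<open>w ! i\<close>.\<close>

lemma is_rgf_iff_smaller_letters_before:
  "is_rgf w \<longleftrightarrow> w \<noteq> [] \<and>
     (\<forall>i<length w. 0 < w ! i \<and> (\<forall>c. 0 < c \<and> c < w ! i \<longrightarrow> (\<exists>m<i. w ! m = c)))"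
  (is "_ \<longleftrightarrow> ?R")
proof
  assume w: "is_rgf w"
  \<comment> \<open>The non-strict version is the one that goes through the induction:
    \<open>c\<close> may equal the maximum attained at the earlier position
    \<open>m\<close>.\<close>
  have "\<exists>m\<le>i. w ! m = c" if "i < length w" "0 < c" "c \<le> w ! i" for i c
    using that
  proof (induction i arbitrary: c rule: less_induct)
    case (less i)
    show ?case
    proof (cases "i = 0 \<or> c = w ! i")
      case True
      then show ?thesis using w less.prems by (auto simp: is_rgf_def)
    next
      case False
      let ?M = "Max (set (take i w))"
      have "?M \<in> set (take i w)"
        using False less.prems by (intro Max_in) auto
      then obtain m where m: "m < i" "w ! m = ?M"
        using less.prems by (auto simp: in_set_conv_nth)
      have "w ! i \<le> 1 + ?M"
        using w False less.prems by (simp add: is_rgf_def)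
      then have "c \<le> w ! m" using False less.prems m by linarith
      then obtain m' where "m' \<le> m" "w ! m' = c"
        using less.IH[of m c] less.prems m by auto
      then show ?thesis using m by (intro exI[of _ m']) auto
    qed
  qed
  then have "\<exists>m<i. w ! m = c" if "i < length w" "0 < c" "c < w ! i" for i c
    using that by (metis nat_less_le)
  moreover have "0 < w ! i" if "i < length w" for i
    using w that nth_mem[of i w] unfolding is_rgf_def by (metis not_one_le_zero gr0I)
  ultimately show ?R using w by (auto simp: is_rgf_def)
next
  assume R: ?R
  have "w ! i \<le> 1 + Max (set (take i w))" if i: "1 \<le> i" "i < length w" for i
  proof (cases "w ! i = 1")
    case False
    then have "0 < w ! i - 1" "w ! i - 1 < w ! i"
      using R i by (metis One_nat_def Suc_lessI zero_less_diff, metis R i(2) diff_less zero_less_one)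
    then obtain m where "m < i" "w ! m = w ! i - 1" using R i by blast
    moreover have "w ! m \<in> set (take i w)"
      using \<open>m < i\<close> i by (auto simp: in_set_conv_nth intro!: exI[of _ m])
    ultimately have "w ! i - 1 \<le> Max (set (take i w))" by (metis List.finite_set Max_ge)
    then show ?thesis by simp
  qed simp
  \<comment> \<open>No position precedes 0, so no positive letter lies below
    \<open>w ! 0\<close>.\<close>
  moreover have "w ! 0 = 1"
    using R by (metis One_nat_def gr0I less_nat_zero_code length_greater_0_conv linorder_neqE_nat zero_less_one less_one)
  ultimately show "is_rgf w"
    using R by (auto simp: is_rgf_def in_set_conv_nth Suc_le_eq)
qed

section \<open>Ordering blocks by their minima\<close>

lemma inj_on_Min_partition:
  fixes A :: "'a::linorder set"
  assumes "finite A" "partition_on A P"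
  shows "inj_on Min P"
proof (rule inj_onI)
  fix B C assume BC: "B \<in> P" "C \<in> P" "Min B = Min C"
  have "finite B" "finite C" "B \<noteq> {}" "C \<noteq> {}"
    using assms BC by (auto simp: partition_on_def intro: finite_subset)
  then have "Min B \<in> B \<inter> C" using BC(3) by (metis IntI Min_in)
  then show "B = C"
    using assms(2) BC by (auto simp: partition_on_def disjoint_def)
qed

lemma (in linorder) sorted_key_list_of_set_inj_on:
  assumes "inj_on f A" "finite A"
  shows "set (sorted_key_list_of_set f A) = A"
    and "sorted_wrt (<) (map f (sorted_key_list_of_set f A))"
proof -
  interpret folding_insort_key "(\<le>)" "(<)" A f using assms(1) by unfold_locales
  show "set (sorted_key_list_of_set f A) = A" using assms(2) by simp
  show "sorted_wrt (<) (map f (sorted_key_list_of_set f A))" by simp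
qed

text \<open>This identifies \<open>ordered_blocks\<close> of a concrete partition: it suffices to
  exhibit its blocks in a list with strictly increasing minima.\<close>

lemma (in linorder) sorted_key_list_of_set_eqI:
  assumes "sorted_wrt (<) (map f xs)"
  shows "sorted_key_list_of_set f (set xs) = xs"
proof -
  have sorted: "sorted (map f xs)" and dist: "distinct (map f xs)"
    using assms by (simp_all add: strict_sorted_iff)
  then interpret folding_insort_key "(\<le>)" "(<)" "set xs" f
    by unfold_locales (simp add: distinct_map)
  show ?thesis using idem_if_sorted_distinct[OF subset_refl sorted distinct_if_distinct_map[OF dist]] .
qed

lemma ordered_blocks:
  assumes "finite A" "partition_on A \<sigma>"
  shows set_ordered_blocks: "set (ordered_blocks \<sigma>) = \<sigma>"
    and sorted_ordered_blocks: "sorted_wrt (<) (map Min (ordered_blocks \<sigma>))"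
  unfolding ordered_blocks_def
  using sorted_key_list_of_set_inj_on[OF inj_on_Min_partition[OF assms] finite_elements[OF assms]]
  by blast+

section \<open>The word of a set partition\<close>

lemma length_rgf_of [simp]: "length (rgf_of n \<sigma>) = n"
  by (simp add: rgf_of_def)

lemma ordered_blocks_inject:
  assumes "finite A" "partition_on A \<sigma>" "x \<in> ordered_blocks \<sigma> ! j" "x \<in> ordered_blocks \<sigma> ! k"
    and "j < length (ordered_blocks \<sigma>)" "k < length (ordered_blocks \<sigma>)"
  shows "j = k"
proof -
  have "ordered_blocks \<sigma> ! j \<in> \<sigma>" "ordered_blocks \<sigma> ! k \<in> \<sigma>"
    using assms(5,6) set_ordered_blocks[OF assms(1,2)] nth_mem by blast+
  then have "ordered_blocks \<sigma> ! j = ordered_blocks \<sigma> ! k"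
    using assms(2-4) by (auto simp: partition_on_def disjoint_def)
  moreover have "distinct (ordered_blocks \<sigma>)"
    using sorted_ordered_blocks[OF assms(1,2)] by (metis distinct_map strict_sorted_iff)
  ultimately show ?thesis using assms by (simp add: nth_eq_iff_index_eq)
qed

text \<open>This removes \<open>THE\<close> from later arguments: the blocks cover
  \<open>Suc i\<close>, and disjointness makes the index unique. One \<open>Suc\<close> turns a word
  position into an element of the ground set, the other a list index into a letter.\<close>

lemma rgf_of_nth_eq_iff:
  assumes "partition_on {1..n} \<sigma>" "i < n"
  shows "rgf_of n \<sigma> ! i = Suc j \<longleftrightarrow>
    j < length (ordered_blocks \<sigma>) \<and> Suc i \<in> ordered_blocks \<sigma> ! j"
proof -
  let ?P = "\<lambda>j. j < length (ordered_blocks \<sigma>) \<and> Suc i \<in> ordered_blocks \<sigma> ! j"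
  have "Suc i \<in> \<Union>\<sigma>" using assms by (auto simp: partition_on_def)
  then obtain B where "B \<in> set (ordered_blocks \<sigma>)" "Suc i \<in> B"
    using set_ordered_blocks[OF _ assms(1)] by auto
  then obtain m where m: "?P m" by (auto simp: in_set_conv_nth)
  have unique: "k = m" if "?P k" for k
    using ordered_blocks_inject[OF finite_atLeastAtMost assms(1)] m that by blast
  have "rgf_of n \<sigma> ! i = Suc (THE j. ?P j)"
    using assms(2) by (simp add: rgf_of_def del: upt_Suc)
  also have "(THE j. ?P j) = m" using m unique by (rule the_equality)
  finally have "rgf_of n \<sigma> ! i = Suc j \<longleftrightarrow> j = m" by auto
  with m unique[of j] show ?thesis by metis
qed

lemma rgf_of_nth:
  assumes "partition_on {1..n} \<sigma>" "i < n"
  obtains j where "rgf_of n \<sigma> ! i = Suc j" "j < length (ordered_blocks \<sigma>)"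
    "Suc i \<in> ordered_blocks \<sigma> ! j"
proof -
  have "rgf_of n \<sigma> ! i = Suc (rgf_of n \<sigma> ! i - 1)"
    using assms(2) by (simp add: rgf_of_def del: upt_Suc)
  with rgf_of_nth_eq_iff[OF assms] that show ?thesis by metis
qed

lemma rgf_of_nth_eq_nth_iff:
  assumes "partition_on {1..n} \<sigma>" "i < n" "j < n"
  shows "rgf_of n \<sigma> ! i = rgf_of n \<sigma> ! j \<longleftrightarrow> (\<exists>B\<in>\<sigma>. Suc i \<in> B \<and> Suc j \<in> B)"
proof
  assume eq: "rgf_of n \<sigma> ! i = rgf_of n \<sigma> ! j"
  obtain k where "rgf_of n \<sigma> ! i = Suc k" "k < length (ordered_blocks \<sigma>)"
    "Suc i \<in> ordered_blocks \<sigma> ! k"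
    using rgf_of_nth[OF assms(1,2)] .
  with eq show "\<exists>B\<in>\<sigma>. Suc i \<in> B \<and> Suc j \<in> B"
    using rgf_of_nth_eq_iff[OF assms(1,3)] set_ordered_blocks[OF _ assms(1)] nth_mem
    by (metis finite_atLeastAtMost)
next
  assume "\<exists>B\<in>\<sigma>. Suc i \<in> B \<and> Suc j \<in> B"
  then obtain k where "k < length (ordered_blocks \<sigma>)"
    "Suc i \<in> ordered_blocks \<sigma> ! k" "Suc j \<in> ordered_blocks \<sigma> ! k"
    using set_ordered_blocks[OF _ assms(1)] by (metis finite_atLeastAtMost in_set_conv_nth)
  then show "rgf_of n \<sigma> ! i = rgf_of n \<sigma> ! j"
    using assms rgf_of_nth_eq_iff by metis
qed

text \<open>If \<open>Suc i\<close> lies in the block at index \<open>j\<close> and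
  \<open>k < j\<close>, then the minimum of the block at index \<open>k\<close> is below
  \<open>Suc i\<close>; the position of that minimum is an earlier occurrence of the letter
  \<open>Suc k\<close>.\<close>

lemma is_rgf_rgf_of:
  assumes \<sigma>: "partition_on {1..n} \<sigma>" and n: "n \<ge> 1"
  shows "is_rgf (rgf_of n \<sigma>)"
proof -
  have "\<exists>m<i. rgf_of n \<sigma> ! m = c"
    if i: "i < n" and c: "0 < c" "c < rgf_of n \<sigma> ! i" for i c
  proof -
    let ?xs = "ordered_blocks \<sigma>"
    obtain j where j: "rgf_of n \<sigma> ! i = Suc j" "j < length ?xs" "Suc i \<in> ?xs ! j"
      using rgf_of_nth[OF \<sigma> i] .
    obtain k where k: "c = Suc k" "k < j" using c j by (cases c) auto
    have "?xs ! k \<in> \<sigma>" "?xs ! j \<in> \<sigma>"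
      using j k nth_mem[of _ ?xs] set_ordered_blocks[OF _ \<sigma>] by simp_all
    then have sub: "?xs ! k \<subseteq> {1..n}" "?xs ! j \<subseteq> {1..n}" and "?xs ! k \<noteq> {}"
      using \<sigma> by (auto simp: partition_on_def)
    then have mem: "Min (?xs ! k) \<in> ?xs ! k"
      by (meson Min_in finite_atLeastAtMost finite_subset)
    have "Min (?xs ! k) < Min (?xs ! j)"
      using sorted_ordered_blocks[OF _ \<sigma>] j k
      by (auto simp: sorted_wrt_iff_nth_less)
    also have "\<dots> \<le> Suc i" using j(3) sub(2) by (meson Min_le finite_atLeastAtMost finite_subset)
    finally obtain m where m: "Min (?xs ! k) = Suc m" "m < i"
      using mem sub(1) by (cases "Min (?xs ! k)") auto
    then have "rgf_of n \<sigma> ! m = c"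
      using rgf_of_nth_eq_iff[OF \<sigma>, of m k] mem i j k by auto
    with m show ?thesis by blast
  qed
  moreover have "0 < rgf_of n \<sigma> ! i" if "i < n" for i
    using rgf_of_nth[OF \<sigma> that] by (metis zero_less_Suc)
  moreover have "rgf_of n \<sigma> \<noteq> []"
    using n by (metis length_rgf_of list.size(3) not_one_le_zero)
  ultimately show ?thesis
    by (auto simp: is_rgf_iff_smaller_letters_before)
qed

section \<open>The set partition of a word\<close>

definition letter_positions :: "nat list \<Rightarrow> nat \<Rightarrow> nat set" where
  "letter_positions w a = Suc ` occurrences w a"

lemma Suc_mem_letter_positions [simp]:
  "Suc i \<in> letter_positions w a \<longleftrightarrow> i < length w \<and> w ! i = a"
  by (auto simp: letter_positions_def occurrences_def)

lemma partition_on_letter_positions: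
  "partition_on {1..length w} (letter_positions w ` set w)"
proof (rule partition_onI)
  have "x \<in> (\<Union>a\<in>set w. letter_positions w a) \<longleftrightarrow> x \<in> {1..length w}" for x
  proof (cases x)
    case 0
    then show ?thesis by (simp add: letter_positions_def image_iff)
  qed auto
  then show "\<Union> (letter_positions w ` set w) = {1..length w}" by blast
qed (auto simp: letter_positions_def occurrences_def disjnt_def in_set_conv_nth)

text \<open>All positive letters below the maximum occur before it, so the letters are exactly 1 up
  to the maximum. The first occurrence of \<open>b\<close> is preceded by every smaller letter
  \<open>a\<close>, so the minima increase with the letter.\<close>

lemma ordered_blocks_letter_positions:
  assumes "is_rgf w"
  shows "ordered_blocks (letter_positions w ` set w) =
    map (letter_positions w) [1..<Suc (Max (set w))]"
proof -
  note R = assms[unfolded is_rgf_iff_smaller_letters_before]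
  let ?M = "Max (set w)"
  have "?M \<in> set w" using R by (intro Max_in) auto
  then obtain i where i: "i < length w" "w ! i = ?M" by (auto simp: in_set_conv_nth)
  have letters: "set w = {1..<Suc ?M}"
  proof (intro equalityI subsetI)
    fix a assume "a \<in> set w"
    then show "a \<in> {1..<Suc ?M}"
      using R by (auto simp: in_set_conv_nth less_Suc_eq_le Suc_le_eq)
  next
    fix a assume a: "a \<in> {1..<Suc ?M}"
    show "a \<in> set w"
    proof (cases "a = ?M")
      case False
      then have "0 < a" "a < w ! i" using a i(2) by auto
      then obtain m where "m < i" "w ! m = a" using R i(1) by blast
      then show ?thesis using i by auto
    qed (use \<open>?M \<in> set w\<close> in simp)
  qed
  then have set: "set (map (letter_positions w) [1..<Suc ?M]) = letter_positions w ` set w"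
    by (metis set_map set_upt)
  have fin: "finite (letter_positions w a)" for a
    by (simp add: letter_positions_def occurrences_def)
  have "Min (letter_positions w a) < Min (letter_positions w b)"
    if ab: "1 \<le> a" "a < b" "b < Suc ?M" for a b
  proof -
    have "b \<in> set w" using ab by (intro equalityD2[OF letters, THEN subsetD]) simp
    then have "Min (letter_positions w b) \<in> letter_positions w b"
      using fin by (intro Min_in) (auto simp: letter_positions_def occurrences_def in_set_conv_nth)
    then obtain k where k: "Min (letter_positions w b) = Suc k" "k < length w" "w ! k = b"
      by (auto simp: letter_positions_def occurrences_def)
    then obtain m where m: "m < k" "w ! m = a" using R ab by (metis One_nat_def Suc_le_eq)
    then have "Min (letter_positions w a) \<le> Suc m"
      using k by (intro Min_le fin) simp
    then show ?thesis using k m by simp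
  qed
  then have "sorted_wrt (<) (map Min (map (letter_positions w) [1..<Suc ?M]))"
    by (auto simp: sorted_wrt_iff_nth_less simp del: upt_Suc)
  from sorted_key_list_of_set_eqI[OF this] show ?thesis
    unfolding ordered_blocks_def set .
qed

text \<open>The positions of the letter \<open>Suc j\<close> form the block at list index
  \<open>j\<close>, and the \<open>Suc\<close> in \<open>rgf_of\<close> gives that letter
  back.\<close>

lemma rgf_of_letter_positions:
  assumes "is_rgf w"
  shows "rgf_of (length w) (letter_positions w ` set w) = w"
proof (rule nth_equalityI)
  fix i assume "i < length (rgf_of (length w) (letter_positions w ` set w))"
  then have i: "i < length w" by simp
  obtain j where j: "rgf_of (length w) (letter_positions w ` set w) ! i = Suc j"
    "j < Max (set w)" "Suc i \<in> letter_positions w (Suc j)"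
    using rgf_of_nth[OF partition_on_letter_positions i]
    by (auto simp: ordered_blocks_letter_positions[OF assms] simp del: upt_Suc)
  then show "rgf_of (length w) (letter_positions w ` set w) ! i = w ! i" by simp
qed simp

section \<open>The pattern 134/2 as a subword\<close>

text \<open>The word form of 134/2: a subword abaa, not necessarily consecutive. The letter b may be
  smaller or larger than a, as only membership in a different block matters.\<close>

definition contains_abaa :: "nat list \<Rightarrow> nat \<Rightarrow> bool" where
  "contains_abaa w a \<longleftrightarrow> (\<exists>i j k l. i < j \<and> j < k \<and> k < l \<and> l < length w \<and>
     w ! i = a \<and> w ! j \<noteq> a \<and> w ! k = a \<and> w ! l = a)"

text \<open>Standardizing replaces each element of \<open>A\<close> by its rank in \<open>A\<close>.
  Ranks are monotone, so elements of ranks 1, 2, 3, 4 appear in this order; conversely, four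
  elements in this order have these ranks in the set they form.\<close>

lemma contains_134_2_iff:
  assumes \<sigma>: "partition_on {1..n} \<sigma>"
  shows "contains_pattern \<sigma> {{1, 3, 4}, {2}} \<longleftrightarrow>
    (\<exists>B\<in>\<sigma>. \<exists>i\<in>B. \<exists>k\<in>B. \<exists>l\<in>B. \<exists>j\<in>{1..n} - B. i < j \<and> j < k \<and> k < l)"
    (is "_ \<longleftrightarrow> ?R")
proof
  assume "contains_pattern \<sigma> {{1, 3, 4}, {2}}"
  then obtain A where A: "A \<subseteq> {1..n}" "standardize (subpartition A \<sigma>) = {{1, 3, 4}, {2}}"
    using \<sigma> by (auto simp: contains_pattern_def partition_on_def)
  have Un: "\<Union>(subpartition A \<sigma>) = A"
  proof -
    have "\<Union>(subpartition A \<sigma>) = (\<Union>B\<in>\<sigma>. A \<inter> B)" by (auto simp: subpartition_def)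
    also have "\<dots> = A \<inter> \<Union>\<sigma>" by blast
    also have "\<dots> = A" using A(1) partition_onD1[OF \<sigma>] by auto
    finally show ?thesis .
  qed
  \<comment> \<open>With the union known to be \<open>A\<close>, this is the relabelling map of
    \<open>standardize\<close>.\<close>
  define r where "r x = card {y \<in> A. y \<le> x}" for x
  have "finite A" using A(1) finite_subset by blast
  then have "r x \<le> r y" if "x \<le> y" for x y
    using that unfolding r_def by (intro card_mono) auto
  then have less: "x < y" if "r x < r y" for x y
    using that by (meson not_le)
  have img: "(`) r ` subpartition A \<sigma> = {{1, 3, 4}, {2}}"
    using A(2) by (simp add: standardize_def Un r_def image_def)
  have "{1, 3, 4} \<in> (`) r ` subpartition A \<sigma>" unfolding img by simp
  then obtain B' where B': "{1, 3, 4} = r ` B'" "B' \<in> subpartition A \<sigma>" by (rule imageE)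
  have "{2} \<in> (`) r ` subpartition A \<sigma>" unfolding img by simp
  then obtain C where C: "{2} = r ` C" "C \<in> subpartition A \<sigma>" by (rule imageE)
  obtain B where B: "B \<in> \<sigma>" "B' = A \<inter> B" using B'(2) by (auto simp: subpartition_def)
  have "1 \<in> r ` B'" "3 \<in> r ` B'" "4 \<in> r ` B'" "2 \<in> r ` C" by (simp_all flip: B'(1) C(1))
  then obtain i k l j where ijkl: "i \<in> B'" "r i = 1" "k \<in> B'" "r k = 3" "l \<in> B'" "r l = 4"
    "j \<in> C" "r j = 2" by (auto simp del: One_nat_def)
  have "j \<in> A" using ijkl C(2) by (auto simp: subpartition_def)
  moreover have "j \<notin> B'"
  proof
    assume "j \<in> B'"
    then have "2 \<in> r ` B'" using ijkl by force
    then show False by (simp flip: B'(1))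
  qed
  ultimately have "j \<in> {1..n} - B" using A(1) B by auto
  moreover have "i < j" "j < k" "k < l" using less[of i j] less[of j k] less[of k l] ijkl by simp_all
  moreover have "i \<in> B" "k \<in> B" "l \<in> B" using ijkl B(2) by simp_all
  ultimately show ?R using B(1) by blast
next
  assume ?R
  then obtain B i j k l where B: "B \<in> \<sigma>" "i \<in> B" "k \<in> B" "l \<in> B" "j \<in> {1..n}" "j \<notin> B"
    and less: "i < j" "j < k" "k < l" by blast
  obtain C where C: "C \<in> \<sigma>" "j \<in> C" using B(5) unfolding partition_onD1[OF \<sigma>] by blast
  let ?A = "{i, j, k, l}"
  have disj: "D \<inter> E = {}" if "D \<in> \<sigma>" "E \<in> \<sigma>" "D \<noteq> E" for D E
    using \<sigma> that by (auto simp: partition_on_def disjoint_def)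
  have "B \<inter> C = {}" using B C disj[of B C] by auto
  then have AB: "?A \<inter> B = {i, k, l}" "?A \<inter> C = {j}" using B C by auto
  have empty: "?A \<inter> D = {}" if "D \<in> \<sigma>" "D \<noteq> B" "D \<noteq> C" for D
    using that disj[of D B] disj[of D C] B C by auto
  have "subpartition ?A \<sigma> \<subseteq> {{i, k, l}, {j}}"
  proof
    fix X assume "X \<in> subpartition ?A \<sigma>"
    then obtain D where "D \<in> \<sigma>" "X = ?A \<inter> D" "X \<noteq> {}" by (auto simp: subpartition_def)
    with AB empty[of D] show "X \<in> {{i, k, l}, {j}}" by (cases "D = B"; cases "D = C") simp_all
  qed
  moreover have "?A \<inter> B \<in> subpartition ?A \<sigma>" "?A \<inter> C \<in> subpartition ?A \<sigma>"
    using B(1,2) C unfolding subpartition_def by blast+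
  then have "{{i, k, l}, {j}} \<subseteq> subpartition ?A \<sigma>" unfolding AB by simp
  ultimately have sub: "subpartition ?A \<sigma> = {{i, k, l}, {j}}" by (rule equalityI)
  have Un: "\<Union> {{i, k, l}, {j}} = ?A" by auto
  have "{y \<in> ?A. y \<le> i} = {i}" "{y \<in> ?A. y \<le> j} = {i, j}"
    "{y \<in> ?A. y \<le> k} = {i, j, k}" "{y \<in> ?A. y \<le> l} = ?A"
    using less by auto
  then have "standardize (subpartition ?A \<sigma>) = {{1, 3, 4}, {2}}"
    using less unfolding standardize_def sub Un by (simp add: eval_nat_numeral)
  moreover have "?A \<subseteq> \<Union>\<sigma>" using B C by auto
  ultimately show "contains_pattern \<sigma> {{1, 3, 4}, {2}}"
    unfolding contains_pattern_def by blast
qed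

lemma contains_134_2_iff_contains_abaa:
  assumes \<sigma>: "partition_on {1..n} \<sigma>"
  shows "contains_pattern \<sigma> {{1, 3, 4}, {2}} \<longleftrightarrow> (\<exists>a. contains_abaa (rgf_of n \<sigma>) a)"
proof
  assume "contains_pattern \<sigma> {{1, 3, 4}, {2}}"
  then obtain B i j k l where B: "B \<in> \<sigma>" "i \<in> B" "k \<in> B" "l \<in> B" "j \<notin> B"
    and less: "i < j" "j < k" "k < l"
    using contains_134_2_iff[OF \<sigma>] by blast
  have "B \<subseteq> {1..n}" using B(1) \<sigma> by (auto simp: partition_on_def)
  with B have "1 \<le> i" "l \<le> n" by auto
  with less obtain i' j' k' l' where S: "i = Suc i'" "j = Suc j'" "k = Suc k'" "l = Suc l'"
    by (metis Suc_le_D One_nat_def less_imp_Suc_add)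
  \<comment> \<open>The letter a will be the one at \<open>i'\<close>; \<open>Suc i'\<close> stands
    second so that the memberships match \<open>rgf_of_nth_eq_nth_iff\<close> applied to comparisons
    with that letter.\<close>
  have "\<not> (\<exists>B\<in>\<sigma>. Suc j' \<in> B \<and> Suc i' \<in> B)"
    using B S \<sigma> by (auto simp: partition_on_def disjoint_def)
  moreover have "\<exists>B\<in>\<sigma>. Suc k' \<in> B \<and> Suc i' \<in> B" "\<exists>B\<in>\<sigma>. Suc l' \<in> B \<and> Suc i' \<in> B"
    using B S by auto
  moreover have less': "i' < j'" "j' < k'" "k' < l'" "l' < n" using less S \<open>l \<le> n\<close> by auto
  moreover from less' have "i' < n" "j' < n" "k' < n" by auto
  ultimately have "contains_abaa (rgf_of n \<sigma>) (rgf_of n \<sigma> ! i')"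
    unfolding contains_abaa_def length_rgf_of
    by (intro exI[of _ i'] exI[of _ j'] exI[of _ k'] exI[of _ l'] conjI)
      (simp_all only: rgf_of_nth_eq_nth_iff[OF \<sigma>] simp_thms)
  then show "\<exists>a. contains_abaa (rgf_of n \<sigma>) a" ..
next
  assume "\<exists>a. contains_abaa (rgf_of n \<sigma>) a"
  then obtain i j k l where less: "i < j" "j < k" "k < l" "l < n"
    and eq: "rgf_of n \<sigma> ! i = rgf_of n \<sigma> ! k" "rgf_of n \<sigma> ! i = rgf_of n \<sigma> ! l"
      "rgf_of n \<sigma> ! i \<noteq> rgf_of n \<sigma> ! j"
    unfolding contains_abaa_def by auto
  obtain B where B: "B \<in> \<sigma>" "Suc i \<in> B" "Suc k \<in> B"
    using eq(1) less rgf_of_nth_eq_nth_iff[OF \<sigma>] by auto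
  moreover obtain C where C: "C \<in> \<sigma>" "Suc i \<in> C" "Suc l \<in> C"
    using eq(2) less rgf_of_nth_eq_nth_iff[OF \<sigma>] by auto
  moreover have "B = C" using B C \<sigma> by (auto simp: partition_on_def disjoint_def)
  moreover have "Suc j \<notin> B"
    using eq(3) less B rgf_of_nth_eq_nth_iff[OF \<sigma>, of i j] by auto
  ultimately show "contains_pattern \<sigma> {{1, 3, 4}, {2}}"
    unfolding contains_134_2_iff[OF \<sigma>] using less
    by (intro bexI[of _ B] bexI[of _ "Suc i"] bexI[of _ "Suc k"] bexI[of _ "Suc l"]
        bexI[of _ "Suc j"]) auto
qed

section \<open>Block letters and block-singleton letters\<close>

lemma first_letter_block:
  assumes "a \<in> set w"
  obtains i j where "letter_block w a i j" "\<And>k. k < i \<Longrightarrow> w ! k \<noteq> a"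
proof -
  define i where "i = (LEAST i. i < length w \<and> w ! i = a)"
  have i: "i < length w" "w ! i = a"
    using assms LeastI_ex[of "\<lambda>i. i < length w \<and> w ! i = a"]
    by (auto simp: i_def in_set_conv_nth)
  have before: "w ! k \<noteq> a" if "k < i" for k
    using not_less_Least[of k "\<lambda>i. i < length w \<and> w ! i = a"] that i by (auto simp: i_def)
  \<comment> \<open>The end of the block is the first later position with another letter, or the
    length of the word if there is none.\<close>
  let ?P = "\<lambda>j. i < j \<and> (j = length w \<or> w ! j \<noteq> a)"
  define j where "j = (LEAST j. ?P j)"
  have P: "?P (length w)" using i by simp
  have j: "?P j" unfolding j_def by (rule LeastI[of ?P, OF P])
  have "j \<le> length w" unfolding j_def by (rule Least_le[of ?P, OF P])
  moreover have "w ! k = a" if "i \<le> k" "k < j" for k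
  proof (cases "k = i")
    case False
    then show ?thesis using not_less_Least[of k ?P] that by (auto simp: j_def)
  qed (simp add: i)
  ultimately have "letter_block w a i j"
    using j before[of "i - 1"] unfolding letter_block_def
    by (cases "i = 0") (simp_all add: Ball_def)
  with before that show ?thesis by blast
qed

text \<open>Two occurrences beyond the first block, together with its start \<open>i\<close> and the
  interrupting position \<open>j\<close>, would form abaa. Conversely, in both shapes all
  occurrences except possibly the last fill an interval, leaving no room for a b before two further
  occurrences.\<close>

lemma not_contains_abaa_iff:
  assumes "a \<in> set w"
  shows "\<not> contains_abaa w a \<longleftrightarrow> block_letter w a \<or> block_singleton_letter w a"
proof
  assume avoid: "\<not> contains_abaa w a"
  obtain i j where ij: "letter_block w a i j" and before: "\<And>k. k < i \<Longrightarrow> w ! k \<noteq> a"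
    using first_letter_block[OF assms] by metis
  have "i < j" "w ! i = a" and block: "{i..<j} \<subseteq> occurrences w a"
    using ij by (auto simp: letter_block_def occurrences_def)
  have after: "j < k \<and> k < length w \<and> w ! k = a \<and> w ! j \<noteq> a"
    if "k \<in> occurrences w a - {i..<j}" for k
  proof -
    have k: "k < length w" "w ! k = a" using that by (auto simp: occurrences_def)
    then have "j \<le> k" using that before[of k] by force
    moreover have "w ! j \<noteq> a" using ij k \<open>j \<le> k\<close> by (auto simp: letter_block_def)
    ultimately show ?thesis using k by (metis le_neq_implies_less)
  qed
  show "block_letter w a \<or> block_singleton_letter w a"
  proof (cases "occurrences w a \<subseteq> {i..<j}")
    case True
    then show ?thesis using ij block by (auto simp: block_letter_def)
  next
    case False
    then obtain l where l: "l \<in> occurrences w a - {i..<j}" by blast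
    have "m = l" if m: "m \<in> occurrences w a - {i..<j}" for m
      using avoid after[OF l] after[OF m] \<open>i < j\<close> \<open>w ! i = a\<close>
      unfolding contains_abaa_def by (cases m l rule: linorder_cases) blast+
    then have "occurrences w a = {i..<j} \<union> {l}" using l block by blast
    then show ?thesis using ij after[OF l] by (auto simp: block_singleton_letter_def)
  qed
next
  assume "block_letter w a \<or> block_singleton_letter w a"
  then obtain i j where "occurrences w a = {i..<j} \<or>
      (\<exists>l>j. occurrences w a = {i..<j} \<union> {l})"
    by (auto simp: block_letter_def block_singleton_letter_def)
  \<comment> \<open>As \<open>r\<close> is not the last occurrence, it is not the isolated
    \<open>l\<close>; so \<open>p\<close> and \<open>r\<close> both lie in the interval, and
    \<open>q\<close> with them.\<close>
  then have between: "q \<in> occurrences w a"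
    if "p \<in> occurrences w a" "r \<in> occurrences w a" "s \<in> occurrences w a"
      "p < q" "q < r" "r < s" for p q r s
  proof (elim disjE exE conjE)
    assume "occurrences w a = {i..<j}"
    then show ?thesis using that by simp
  next
    fix l assume "j < l" "occurrences w a = {i..<j} \<union> {l}"
    then show ?thesis using that by simp linarith
  qed
  show "\<not> contains_abaa w a"
  proof
    assume "contains_abaa w a"
    then obtain p q r s where "p < q" "q < r" "r < s" "s < length w"
      "w ! p = a" "w ! q \<noteq> a" "w ! r = a" "w ! s = a"
      by (auto simp: contains_abaa_def)
    with between[of p r s q] show False by (auto simp: occurrences_def)
  qed
qed

lemma contains_abaa_imp_mem: "contains_abaa w a \<Longrightarrow> a \<in> set w"
  by (auto simp: contains_abaa_def in_set_conv_nth)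

theorem theorem3p7:
  fixes n :: nat
  assumes "n \<ge> 1"
  shows "avoiding_rgfs n {{1, 3, 4}, {2}} =
    {w. is_rgf w \<and> length w = n \<and>
        (\<forall>a \<in> set w. block_letter w a \<or> block_singleton_letter w a)}"
    (is "_ = {w. ?good w}")
proof -
  \<comment> \<open>Letters absent from \<open>w\<close> cannot form abaa, so the quantifier over
    \<open>set w\<close> extends to all letters.\<close>
  have avoids: "(\<forall>a \<in> set w. block_letter w a \<or> block_singleton_letter w a) \<longleftrightarrow>
    (\<nexists>a. contains_abaa w a)" for w
    using not_contains_abaa_iff contains_abaa_imp_mem by metis
  show ?thesis
  proof (intro equalityI subsetI)
    fix w assume "w \<in> avoiding_rgfs n {{1, 3, 4}, {2}}"
    then obtain \<sigma> where "partition_on {1..n} \<sigma>" "\<not> contains_pattern \<sigma> {{1, 3, 4}, {2}}"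
      and "w = rgf_of n \<sigma>"
      by (auto simp: avoiding_rgfs_def avoiding_partitions_def)
    then show "w \<in> {w. ?good w}"
      using is_rgf_rgf_of assms contains_134_2_iff_contains_abaa avoids by simp
  next
    fix w assume "w \<in> {w. ?good w}"
    then have w: "is_rgf w" "length w = n" "\<nexists>a. contains_abaa w a"
      using avoids by auto
    let ?\<sigma> = "letter_positions w ` set w"
    have "partition_on {1..n} ?\<sigma>" "rgf_of n ?\<sigma> = w"
      using partition_on_letter_positions[of w] rgf_of_letter_positions[OF w(1)] w(2) by auto
    then show "w \<in> avoiding_rgfs n {{1, 3, 4}, {2}}"
      using contains_134_2_iff_contains_abaa[of n ?\<sigma>] w(3)
      unfolding avoiding_rgfs_def avoiding_partitions_def by (intro image_eqI[of _ _ ?\<sigma>]) auto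
  qed
qed

end
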